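(* For all $m,n\in\mathbb{Z}$, we have $$N(m,n)\le g(n-|m|)=p(n-1-|m|)-p(n-2-|m|),$$ and the inequality is an equality if $|m|\ge\frac n2-2$.
   Context: A partition of a positive integer $n$ is a nonincreasing sequence $\lambda=(\lambda_1,\ldots,\lambda_k)$ of positive integers (called the parts of $\lambda$) with sum $n$. $P(n)$ denotes the set of partitions of $n$, with $P(n)=\emptyset$ if $n$ is not a positive integer. The partition function is $p(n)=|P(n)|$ for integers $n\ge 1$, $p(0)=1$, and $p(x)=0$ if $x$ is not a non-negative integer. The (Dyson) rank of $\lambda=(\lambda_1,\ldots,\lambda_k)$ with $\lambda_1\ge\cdots\ge\lambda_k\ge1$ is $\operatorname{rank}(\lambda):=\lambda_1-k$. $N(m,n)$ denotes the number of $\lambda\in P(n)$ with $\operatorname{rank}(\lambda)=m$. For an integer $k$, $g(k)$ denotes the number of partitions $\lambda\in P(k)$ for which the number of parts of $\lambda$ is itself a part of $\lambda$ (so $g(k)=0$ for $k\le 0$). *)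

theory Defs
  imports Complex_Main
begin

definition partitions :: "int \<Rightarrow> nat list set" where
  "partitions n =
     {l. n > 0 \<and> sorted_wrt (\<ge>) l \<and> (\<forall>x\<in>set l. x > 0) \<and> int (sum_list l) = n}"

text \<open>
  The condition \<open>n > 0\<close> excludes the empty list, so \<open>partitions 0 = {}\<close>; the value \<open>p(0) = 1\<close>
  is a separate convention.
\<close>

definition partition_count :: "int \<Rightarrow> nat" where
  "partition_count n = (if n = 0 then 1 else card (partitions n))"

definition dyson_rank :: "nat list \<Rightarrow> int" where
  "dyson_rank l = int (hd l) - int (length l)"

definition rank_count :: "int \<Rightarrow> int \<Rightarrow> nat" where
  "rank_count m n = card {l \<in> partitions n. dyson_rank l = m}"

definition length_part_count :: "int \<Rightarrow> nat" where
  "length_part_count k = card {l \<in> partitions k. length l \<in> set l}"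

text \<open>By this lemma none of the \<open>card\<close> values above is the default \<open>0\<close> of an infinite set.\<close>

lemma finite_partitions: "finite (partitions n)"
proof (rule finite_subset)
  have len: "length l \<le> sum_list l" if "\<forall>x\<in>set l. x > 0" for l :: "nat list"
    using that by (induction l) auto
  show "partitions n \<subseteq> {l. set l \<subseteq> {..nat n} \<and> length l \<le> nat n}"
    using len by (auto simp: partitions_def dest: member_le_sum_list)
  show "finite {l. set l \<subseteq> {..nat n} \<and> length l \<le> nat n}"
    by (rule finite_lists_length_le) simp
qed

end

theory Submission
  imports Defs "HOL-Library.FuncSet" "HOL-Library.Multiset"
begin

text \<open>
  Two modifications of a single part explain all three claims.

  Let a partition of \<open>k\<close> have its number of parts, \<open>s\<close>, among its parts. Remove one part \<open>s\<close> and
  add \<open>1\<close> to each of the \<open>s - 1\<close> others: the sum becomes \<open>k - s + (s - 1) = k - 1\<close> and no part is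
  \<open>1\<close>. Since \<open>s\<close> can be read off the result, this is a bijection onto the partitions of \<open>k - 1\<close>
  without a part \<open>1\<close> (\<open>length_part_count_eq_without_1\<close>), and there are \<open>p(k - 1) - p(k - 2)\<close> of
  those, because the partitions with a part \<open>1\<close> arise by adjoining it to a partition of \<open>k - 2\<close>.

  Conjugation negates the rank, so only ranks \<open>m \<ge> 0\<close> need to be considered
  (\<open>rank_count_minus\<close>). A partition of \<open>n\<close> of rank \<open>m\<close> with \<open>s\<close> parts has largest part \<open>s + m\<close>.
  Replacing one copy of it by \<open>s\<close> gives a partition of \<open>n - m\<close> that still has \<open>s\<close> parts, one of
  which is \<open>s\<close>, and the replacement can be undone. The partitions reached are those counted by
  \<open>g(n - m)\<close> in which no part exceeds \<open>s + m\<close> (\<open>rank_count_of_nat\<close>). This proves the inequality,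
  and equality holds as soon as the bound on the parts is automatic. A part \<open>x \<noteq> s\<close> leaves
  \<open>s - 2\<close> further parts besides itself and \<open>s\<close>, so \<open>s + x + (s - 2) \<le> n - m\<close>; with \<open>s \<ge> 2\<close> and
  \<open>n - m \<le> m + 4\<close> this forces \<open>x \<le> s + m\<close> (\<open>part_le_of_size_mem\<close>).

  Apart from conjugation, which uses the order of the parts, the bijections change individual
  parts of a partition, so they are carried out on multisets, where nothing has to be sorted again.
\<close>

section \<open>Partitions as multisets\<close>

text \<open>
  The rule would move \<open>int\<close> inside the sum of the parts and so break up the equations between this
  sum and the partitioned number.
\<close>

declare of_nat_sum_mset [simp del]

text \<open>
  Unlike in the list version, the empty partition of \<open>0\<close> is included. The convention
  \<open>p(0) = 1\<close> then is no exception, and adjoining or removing a part never has to treat the empty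
  partition separately.
\<close>

definition partition_msets :: "int \<Rightarrow> nat multiset set" where
  "partition_msets n = {M. 0 \<notin># M \<and> int (sum_mset M) = n}"

text \<open>
  A multiset has exactly one nonincreasing enumeration. The empty multiset is excluded because
  there is no list in \<open>partitions 0\<close>.
\<close>

lemma card_partitions_mset:
  "card {l \<in> partitions n. Q (mset l)} = card {M \<in> partition_msets n. M \<noteq> {#} \<and> Q M}"
proof (rule bij_betw_same_card[where f = mset], rule bij_betwI[where g = "\<lambda>M. rev (sorted_list_of_multiset M)"])
  show "mset \<in> {l \<in> partitions n. Q (mset l)} \<rightarrow> {M \<in> partition_msets n. M \<noteq> {#} \<and> Q M}"
    by (auto simp: partitions_def partition_msets_def sum_mset_sum_list)
  show "(\<lambda>M. rev (sorted_list_of_multiset M))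
      \<in> {M \<in> partition_msets n. M \<noteq> {#} \<and> Q M} \<rightarrow> {l \<in> partitions n. Q (mset l)}"
  proof
    fix M assume "M \<in> {M \<in> partition_msets n. M \<noteq> {#} \<and> Q M}"
    then have M: "0 \<notin># M" "int (sum_mset M) = n" "M \<noteq> {#}" "Q M"
      by (auto simp: partition_msets_def)
    have "sum_mset M > 0"
      using M(1,3) by (metis multiset_nonemptyE neq0_conv sum_mset_0_iff)
    moreover have "sum_list (sorted_list_of_multiset M) = sum_mset M"
      by (metis mset_sorted_list_of_multiset sum_mset_sum_list)
    ultimately show "rev (sorted_list_of_multiset M) \<in> {l \<in> partitions n. Q (mset l)}"
      using M sorted_sorted_list_of_multiset[of M]
      by (auto simp: partitions_def sorted_wrt_rev sum_list_rev intro!: gr0I)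
  qed
next
  fix l assume "l \<in> {l \<in> partitions n. Q (mset l)}"
  then have "sorted (rev l)" by (auto simp: partitions_def sorted_wrt_rev)
  then have "sort l = rev l"
    by (metis mset_rev properties_for_sort)
  then show "rev (sorted_list_of_multiset (mset l)) = l" by simp
qed auto

text \<open>
  Each nonempty multiset is enumerated by some list: otherwise counting that multiset alone, via
  \<open>card_partitions_mset\<close>, would give \<open>0\<close> lists for \<open>1\<close> multiset. So finiteness is inherited
  from the lists.
\<close>

lemma finite_partition_msets: "finite (partition_msets n)"
proof -
  have "finite (mset ` partitions n)" by (simp add: finite_partitions)
  moreover have "partition_msets n \<subseteq> insert {#} (mset ` partitions n)"
  proof
    fix M assume "M \<in> partition_msets n"
    show "M \<in> insert {#} (mset ` partitions n)"
    proof (rule ccontr)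
      assume *: "M \<notin> insert {#} (mset ` partitions n)"
      then have "{M' \<in> partition_msets n. M' \<noteq> {#} \<and> M' = M} = {M}"
        using \<open>M \<in> partition_msets n\<close> by auto
      moreover have "{l \<in> partitions n. mset l = M} = {}" using * by auto
      ultimately show False using card_partitions_mset[of n "\<lambda>M'. M' = M"]
        by (metis card.empty card_1_singleton_iff One_nat_def zero_neq_one)
    qed
  qed
  ultimately show ?thesis by (meson finite_insert finite_subset)
qed

lemma partition_count_mset: "partition_count n = card (partition_msets n)"
proof (cases "n = 0")
  case True
  then have "partition_msets n = {{#}}"
    by (auto simp: partition_msets_def) (metis multiset_nonemptyE)
  with True show ?thesis by (simp add: partition_count_def)
next
  case False
  then have "{M \<in> partition_msets n. M \<noteq> {#}} = partition_msets n"
    by (auto simp: partition_msets_def)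
  with False card_partitions_mset[of n "\<lambda>_. True"] show ?thesis
    by (simp add: partition_count_def)
qed

lemma length_part_count_mset:
  "length_part_count k = card {M \<in> partition_msets k. size M \<in># M}"
proof -
  have "{M \<in> partition_msets k. M \<noteq> {#} \<and> size M \<in># M} = {M \<in> partition_msets k. size M \<in># M}"
    by auto
  then show ?thesis
    using card_partitions_mset[of k "\<lambda>M. size M \<in># M"] by (simp add: length_part_count_def)
qed

lemma rank_count_mset:
  "rank_count m n =
     card {M \<in> partition_msets n. M \<noteq> {#} \<and> int (Max_mset M) = int (size M) + m}"
proof -
  have "hd l = Max (set l)" if "l \<in> partitions n" for l
    using that by (cases l) (auto simp: partitions_def intro!: Max_eqI[symmetric])
  then have "{l \<in> partitions n. dyson_rank l = m} =
      {l \<in> partitions n. int (Max_mset (mset l)) = int (size (mset l)) + m}"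
    by (auto simp: dyson_rank_def)
  then show ?thesis
    using card_partitions_mset[of n "\<lambda>M. int (Max_mset M) = int (size M) + m"]
    by (simp add: rank_count_def)
qed

section \<open>Partitions whose number of parts is a part\<close>

text \<open>
  Adjoining a part \<open>1\<close> is a bijection from the partitions of \<open>n - 1\<close> to those partitions of
  \<open>n\<close> that contain a \<open>1\<close>.
\<close>

lemma card_partition_msets_without_1:
  "int (card {M \<in> partition_msets n. 1 \<notin># M})
     = int (partition_count n) - int (partition_count (n - 1))"
proof -
  have "bij_betw (add_mset 1) (partition_msets (n - 1)) {M \<in> partition_msets n. 1 \<in># M}"
    by (rule bij_betwI[where g = "\<lambda>M. M - {#1#}"])
      (auto simp: partition_msets_def dest!: multi_member_split)
  then have "card {M \<in> partition_msets n. 1 \<in># M} = partition_count (n - 1)"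
    by (simp add: bij_betw_same_card partition_count_mset)
  moreover have "partition_msets n =
      {M \<in> partition_msets n. 1 \<notin># M} \<union> {M \<in> partition_msets n. 1 \<in># M}" by auto
  then have "card (partition_msets n) =
      card {M \<in> partition_msets n. 1 \<notin># M} + card {M \<in> partition_msets n. 1 \<in># M}"
    by (metis (no_types, lifting) card_Un_disjoint finite_Un finite_partition_msets
      disjoint_iff mem_Collect_eq)
  ultimately show ?thesis by (simp add: partition_count_mset)
qed

lemma sum_mset_image_Suc: "sum_mset (image_mset Suc M) = sum_mset M + size M"
  by (induction M) auto

lemma image_mset_Suc_pred: "0 \<notin># M \<Longrightarrow> image_mset Suc (image_mset (\<lambda>x. x - 1) M) = M"
  by (induction M) auto

text \<open>
  Remove the part that equals the number \<open>s\<close> of parts and spread all but one unit of it evenly: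
  each of the \<open>s - 1\<close> remaining parts grows by \<open>1\<close>. The inverse recovers \<open>s\<close> as the number of
  parts plus one.
\<close>

lemma length_part_count_eq_without_1:
  "length_part_count k = card {M \<in> partition_msets (k - 1). 1 \<notin># M}"
  unfolding length_part_count_mset
proof (rule bij_betw_same_card[where f = "\<lambda>M. image_mset Suc (M - {#size M#})"],
    rule bij_betwI[where g = "\<lambda>M. add_mset (size M + 1) (image_mset (\<lambda>x. x - 1) M)"])
  show "(\<lambda>M. image_mset Suc (M - {#size M#}))
      \<in> {M \<in> partition_msets k. size M \<in># M} \<rightarrow> {M \<in> partition_msets (k - 1). 1 \<notin># M}"
  proof
    fix M assume "M \<in> {M \<in> partition_msets k. size M \<in># M}"
    moreover from this obtain N where "M = add_mset (size M) N"
      by (auto dest: multi_member_split)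
    moreover from this have "size M = Suc (size N)" by (metis size_add_mset)
    ultimately have "M = add_mset (Suc (size N)) N" "0 \<notin># N" "int (sum_mset M) = k"
      by (auto simp: partition_msets_def)
    then show "image_mset Suc (M - {#size M#}) \<in> {M \<in> partition_msets (k - 1). 1 \<notin># M}"
      by (auto simp: partition_msets_def sum_mset_image_Suc)
  qed
  show "(\<lambda>M. add_mset (size M + 1) (image_mset (\<lambda>x. x - 1) M))
      \<in> {M \<in> partition_msets (k - 1). 1 \<notin># M} \<rightarrow> {M \<in> partition_msets k. size M \<in># M}"
  proof
    fix M assume "M \<in> {M \<in> partition_msets (k - 1). 1 \<notin># M}"
    then have M: "0 \<notin># M" "1 \<notin># M" "int (sum_mset M) = k - 1" by (auto simp: partition_msets_def)
    have "0 \<notin># image_mset (\<lambda>x. x - 1) M"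
    proof
      assume "0 \<in># image_mset (\<lambda>x. x - 1) M"
      then obtain x where "x \<in># M" "x \<le> 1" by auto
      then have "x = 0 \<or> x = 1" by auto
      with M \<open>x \<in># M\<close> show False by auto
    qed
    moreover have "sum_mset M = sum_mset (image_mset (\<lambda>x. x - 1) M) + size M"
      using sum_mset_image_Suc[of "image_mset (\<lambda>x. x - 1) M"] image_mset_Suc_pred[OF M(1)] by simp
    ultimately show "add_mset (size M + 1) (image_mset (\<lambda>x. x - 1) M)
        \<in> {M \<in> partition_msets k. size M \<in># M}"
      using M by (simp add: partition_msets_def)
  qed
next
  fix M assume "M \<in> {M \<in> partition_msets k. size M \<in># M}"
  then obtain N where N: "M = add_mset (size M) N"
    by (auto dest: multi_member_split)
  then have "size M = Suc (size N)" by (metis size_add_mset)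
  with N have "M = add_mset (Suc (size N)) N" by simp
  then show "add_mset (size (image_mset Suc (M - {#size M#})) + 1)
      (image_mset (\<lambda>x. x - 1) (image_mset Suc (M - {#size M#}))) = M"
    by (simp add: multiset.map_comp comp_def)
next
  fix M assume "M \<in> {M \<in> partition_msets (k - 1). 1 \<notin># M}"
  then have "0 \<notin># M" by (simp add: partition_msets_def)
  from image_mset_Suc_pred[OF this]
  show "image_mset Suc (add_mset (size M + 1) (image_mset (\<lambda>x. x - 1) M)
      - {#size (add_mset (size M + 1) (image_mset (\<lambda>x. x - 1) M))#}) = M" by simp
qed

section \<open>Shrinking the largest part\<close>

text \<open>
  For rank \<open>m \<ge> 0\<close> the largest part is \<open>s + m\<close>, where \<open>s\<close> is the number of parts. It is lowered to
  \<open>s\<close>, which keeps the number of parts and so lets the inverse find the part to be raised by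
  \<open>m\<close>. The raised part is a largest one exactly if no part exceeds \<open>s + m\<close>.
\<close>

lemma rank_count_of_nat:
  "rank_count (int m) n =
     card {M \<in> partition_msets (n - int m). size M \<in># M \<and> (\<forall>x\<in>#M. x \<le> size M + m)}"
  unfolding rank_count_mset
proof (rule bij_betw_same_card[where f = "\<lambda>M. add_mset (size M) (M - {#Max_mset M#})"],
    rule bij_betwI[where g = "\<lambda>M. add_mset (size M + m) (M - {#size M#})"])
  let ?A = "{M \<in> partition_msets n. M \<noteq> {#} \<and> int (Max_mset M) = int (size M) + int m}"
  let ?B = "{M \<in> partition_msets (n - int m). size M \<in># M \<and> (\<forall>x\<in>#M. x \<le> size M + m)}"
  \<comment> \<open>Both sides are written in terms of the multiset \<open>N\<close> of the parts that do not change; the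
    number of parts is then \<open>Suc (size N)\<close>.\<close>
  have A: "\<exists>N. M = add_mset (Suc (size N) + m) N \<and> Max_mset M = Suc (size N) + m
      \<and> 0 \<notin># N \<and> (\<forall>x\<in>#N. x \<le> Suc (size N) + m) \<and> int (sum_mset M) = n" if "M \<in> ?A" for M
  proof -
    from that have *: "M \<noteq> {#}" "Max_mset M = size M + m" by auto
    then have "size M + m \<in># M" by (metis Max_in finite_set_mset set_mset_eq_empty_iff)
    then obtain N where N: "M = add_mset (size M + m) N" by (auto dest: multi_member_split)
    then have "size M = Suc (size N)" by (metis size_add_mset)
    moreover have "x \<le> Max_mset M" if "x \<in># N" for x
      using that N by (metis Max_ge finite_set_mset insert_iff set_mset_add_mset_insert)
    moreover have "0 \<notin># N" using that N
      by (metis (mono_tags, lifting) mem_Collect_eq partition_msets_def insert_iff set_mset_add_mset_insert)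
    ultimately show ?thesis using that N *(2)
      by (intro exI[of _ N]) (auto simp: partition_msets_def)
  qed
  have B: "\<exists>N. M = add_mset (Suc (size N)) N
      \<and> 0 \<notin># N \<and> (\<forall>x\<in>#N. x \<le> Suc (size N) + m) \<and> int (sum_mset M) = n - int m" if "M \<in> ?B" for M
  proof -
    from that obtain N where N: "M = add_mset (size M) N" by (auto dest: multi_member_split)
    then have "size M = Suc (size N)" by (metis size_add_mset)
    with N have "M = add_mset (Suc (size N)) N" by simp
    with that show ?thesis
      by (intro exI[of _ N]) (auto simp: partition_msets_def)
  qed
  have Max: "Max_mset (add_mset (Suc (size N) + m) N) = Suc (size N) + m"
    if "\<forall>x\<in>#N. x \<le> Suc (size N) + m" for N
    using that by (auto intro!: Max_eqI)
  show "(\<lambda>M. add_mset (size M) (M - {#Max_mset M#})) \<in> ?A \<rightarrow> ?B"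
  proof
    fix M assume "M \<in> ?A"
    from A[OF this] obtain N where N: "M = add_mset (Suc (size N) + m) N"
      "Max_mset M = Suc (size N) + m" "0 \<notin># N" "\<forall>x\<in>#N. x \<le> Suc (size N) + m"
      "int (sum_mset M) = n" by blast
    then have "add_mset (size M) (M - {#Max_mset M#}) = add_mset (Suc (size N)) N"
      by (metis add_mset_remove_trivial size_add_mset)
    moreover have "int (sum_mset N) = n - int m - 1 - int (size N)"
      using N(1,5) by (metis (no_types) add_diff_cancel_left' diff_diff_eq of_nat_Suc of_nat_add sum_mset.add_mset add.commute)
    ultimately show "add_mset (size M) (M - {#Max_mset M#}) \<in> ?B"
      using N(3,4) by (auto simp: partition_msets_def)
  qed
  show "(\<lambda>M. add_mset (size M + m) (M - {#size M#})) \<in> ?B \<rightarrow> ?A"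
  proof
    fix M assume "M \<in> ?B"
    from B[OF this] obtain N where N: "M = add_mset (Suc (size N)) N"
      "0 \<notin># N" "\<forall>x\<in>#N. x \<le> Suc (size N) + m" "int (sum_mset M) = n - int m" by blast
    then have "add_mset (size M + m) (M - {#size M#}) = add_mset (Suc (size N) + m) N"
      by (metis add_mset_remove_trivial size_add_mset)
    moreover have "int (sum_mset N) = n - int m - 1 - int (size N)"
      using N(1,4) by (metis (no_types) add_diff_cancel_left' diff_diff_eq of_nat_Suc of_nat_add sum_mset.add_mset add.commute)
    ultimately show "add_mset (size M + m) (M - {#size M#}) \<in> ?A"
      using N(2) Max[OF N(3)] by (auto simp: partition_msets_def)
  qed
  show "add_mset (size (add_mset (size M) (M - {#Max_mset M#})) + m)
      (add_mset (size M) (M - {#Max_mset M#})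
        - {#size (add_mset (size M) (M - {#Max_mset M#}))#}) = M" if "M \<in> ?A" for M
  proof -
    from A[OF that] obtain N where N: "M = add_mset (Suc (size N) + m) N"
      "Max_mset M = Suc (size N) + m" by blast
    then have "add_mset (size M) (M - {#Max_mset M#}) = add_mset (Suc (size N)) N"
      by (metis add_mset_remove_trivial size_add_mset)
    with N(1) show ?thesis by simp
  qed
  show "add_mset (size (add_mset (size M + m) (M - {#size M#})))
      (add_mset (size M + m) (M - {#size M#})
        - {#Max_mset (add_mset (size M + m) (M - {#size M#}))#}) = M" if "M \<in> ?B" for M
  proof -
    from B[OF that] obtain N where N: "M = add_mset (Suc (size N)) N"
      "\<forall>x\<in>#N. x \<le> Suc (size N) + m" by blast
    then have "add_mset (size M + m) (M - {#size M#}) = add_mset (Suc (size N) + m) N"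
      by (metis add_mset_remove_trivial size_add_mset)
    with N(1) Max[OF N(2)] show ?thesis by simp
  qed
qed

text \<open>
  If \<open>x\<close> differs from the number \<open>s\<close> of parts, then \<open>s \<ge> 2\<close>, and the \<open>s - 2\<close> parts other than
  \<open>x\<close> and \<open>s\<close> contribute at least \<open>s - 2\<close> to the sum. Hence \<open>x \<le> m + 4 - (2 * s - 2)\<close>, which is
  at most \<open>s + m\<close> since \<open>3 * s \<ge> 6\<close>.
\<close>

lemma part_le_of_size_mem:
  assumes "0 \<notin># M" "size M \<in># M" "x \<in># M" "sum_mset M \<le> m + 4"
  shows "x \<le> size M + m"
proof (cases "x = size M")
  case False
  from assms(2) obtain N where N: "M = add_mset (size M) N" by (auto dest: multi_member_split)
  with False assms(3) have "x \<in># N" by (metis insert_iff set_mset_add_mset_insert)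
  then obtain K where "N = add_mset x K" by (auto dest: multi_member_split)
  with N have M: "M = add_mset (size M) (add_mset x K)" by simp
  have "size K \<le> sum_mset K" if "0 \<notin># K" for K :: "nat multiset"
    using that by (induction K) auto
  moreover have "0 \<notin># K" using assms(1) M by (metis insert_iff set_mset_add_mset_insert)
  ultimately have "size K \<le> sum_mset K" by simp
  moreover have "size M = size K + 2" using M by (metis size_add_mset add_2_eq_Suc')
  moreover have "sum_mset M = size M + (x + sum_mset K)"
    using M by (metis sum_mset.add_mset)
  ultimately show ?thesis using assms(4) by simp
qed simp

section \<open>Conjugation\<close>

definition conjugate :: "nat list \<Rightarrow> nat list" where
  "conjugate l = map (\<lambda>i. length (filter (\<lambda>x. i < x) l)) [0..<hd l]"

text \<open>
  Both sides say that the cell in row \<open>j\<close> and column \<open>i\<close> belongs to the Ferrers diagram, the right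
  side in terms of the length of column \<open>i\<close>: in a nonincreasing list the parts exceeding \<open>i\<close> form
  an initial segment.
\<close>

lemma less_nth_iff_less_length_filter:
  assumes "sorted_wrt (\<ge>) l" "j < length l"
  shows "(i::nat) < l ! j \<longleftrightarrow> j < length (filter (\<lambda>x. i < x) l)"
  using assms
proof (induction l arbitrary: j)
  case (Cons a l)
  show ?case
  proof (cases "i < a")
    case True
    with Cons show ?thesis by (cases j) auto
  next
    case False
    then have "\<forall>x\<in>set (a # l). x \<le> i" using Cons.prems(1) by auto
    moreover from this have "filter (\<lambda>x. i < x) (a # l) = []" by (auto simp: filter_empty_conv)
    ultimately show ?thesis using Cons.prems(2) nth_mem[of j "a # l"] by fastforce
  qed
qed simp

text \<open>Counting the cells of the Ferrers diagram by columns instead of by rows.\<close>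

lemma sum_length_filter:
  assumes "\<forall>x\<in>set l. x \<le> h"
  shows "(\<Sum>i<h. length (filter (\<lambda>x. i < x) l)) = sum_list l"
  using assms
proof (induction l)
  case (Cons a l)
  have "(\<Sum>i<h. length (filter (\<lambda>x. i < x) (a # l)))
      = (\<Sum>i<h. (if i < a then 1 else 0) + length (filter (\<lambda>x. i < x) l))"
    by (intro sum.cong) auto
  also have "\<dots> = (\<Sum>i<h. if i < a then 1 else 0) + sum_list l"
    using Cons by (simp add: sum.distrib)
  also have "(\<Sum>i<h. if i < a then 1 else 0) = card {i \<in> {..<h}. i < a}"
    by (simp add: sum.If_cases Int_def)
  also have "{i \<in> {..<h}. i < a} = {..<a}" using Cons.prems by auto
  finally show ?case by simp
qed simp

lemma le_hd: "sorted_wrt (\<ge>) l \<Longrightarrow> x \<in> set l \<Longrightarrow> x \<le> hd l" for x :: nat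
  by (cases l) auto

lemma conjugate_partition:
  assumes "l \<in> partitions n"
  shows "conjugate l \<in> partitions n" "dyson_rank (conjugate l) = - dyson_rank l"
proof -
  have l: "n > 0" "sorted_wrt (\<ge>) l" "\<forall>x\<in>set l. x > 0" "int (sum_list l) = n"
    using assms by (auto simp: partitions_def)
  then have "l \<noteq> []" by auto
  then have h: "hd l > 0" "hd l \<in> set l" using l by auto
  have "sorted_wrt (\<ge>) (conjugate l)"
    unfolding conjugate_def sorted_wrt_map
  proof (rule sorted_wrt_mono_rel[OF _ sorted_wrt_upt])
    fix i j :: nat assume "i < j"
    have "filter (\<lambda>x. j < x) l = filter (\<lambda>x. j < x) (filter (\<lambda>x. i < x) l)"
      using \<open>i < j\<close> by (auto intro: filter_cong)
    then show "length (filter (\<lambda>x. j < x) l) \<le> length (filter (\<lambda>x. i < x) l)"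
      by (metis length_filter_le)
  qed
  moreover have "\<forall>x\<in>set (conjugate l). x > 0"
    using h(2) by (auto simp: conjugate_def filter_empty_conv)
  moreover have "sum_list (conjugate l) = sum_list l"
    using sum_length_filter[of l "hd l"] le_hd[OF l(2)]
    by (simp add: conjugate_def sum_list_sum_nth atLeast0LessThan)
  ultimately show "conjugate l \<in> partitions n" using l by (simp add: partitions_def)
  have "filter (\<lambda>x. 0 < x) l = l" using l(3) by simp
  then show "dyson_rank (conjugate l) = - dyson_rank l"
    using h(1) by (simp add: dyson_rank_def conjugate_def hd_map)
qed

text \<open>
  The conjugate determines the length of every column of the diagram, hence which cells the diagram
  has, hence its rows. Injectivity is all that the symmetry of the rank requires, since it is
  applied to both \<open>m\<close> and \<open>- m\<close>.
\<close>

lemma inj_on_conjugate: "inj_on conjugate (partitions n)"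
proof (rule inj_onI)
  fix k l assume k: "k \<in> partitions n" and l: "l \<in> partitions n" and eq: "conjugate k = conjugate l"
  have hd: "hd k = hd l" using arg_cong[OF eq, of length] by (simp add: conjugate_def)
  have cols: "length (filter (\<lambda>x. i < x) k) = length (filter (\<lambda>x. i < x) l)" for i
  proof (cases "i < hd l")
    case True
    then show ?thesis using arg_cong[OF eq, of "\<lambda>c. c ! i"] hd by (simp add: conjugate_def)
  next
    case False
    then have "filter (\<lambda>x. i < x) k = []" "filter (\<lambda>x. i < x) l = []"
      using k l hd by (force simp: partitions_def filter_empty_conv dest: le_hd)+
    then show ?thesis by simp
  qed
  have "filter (\<lambda>x. 0 < x) k = k" "filter (\<lambda>x. 0 < x) l = l"
    using k l by (auto simp: partitions_def)
  \<comment> \<open>All parts are positive, so column \<open>0\<close> counts them.\<close>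
  with cols[of 0] have len: "length k = length l" by simp
  show "k = l"
  proof (rule nth_equalityI[OF len])
    fix j assume "j < length k"
    then have "i < k ! j \<longleftrightarrow> i < l ! j" for i
      using k l len cols[of i] by (simp add: partitions_def less_nth_iff_less_length_filter)
    then show "k ! j = l ! j" by (meson linorder_neqE_nat less_irrefl)
  qed
qed

lemma rank_count_minus: "rank_count (- m) n = rank_count m n"
proof -
  have "rank_count m n \<le> rank_count (- m) n" for m
    unfolding rank_count_def
  proof (rule card_inj_on_le[where f = conjugate])
    show "inj_on conjugate {l \<in> partitions n. dyson_rank l = m}"
      using inj_on_conjugate by (rule inj_on_subset) auto
  qed (auto simp: conjugate_partition finite_partitions)
  from this[of m] this[of "- m"] show ?thesis by simp
qed

section \<open>Comparison of the counts\<close>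

theorem proposition2:
  fixes m n :: int
  shows "rank_count m n \<le> length_part_count (n - \<bar>m\<bar>)
       \<and> int (length_part_count (n - \<bar>m\<bar>)) =
           int (partition_count (n - 1 - \<bar>m\<bar>)) - int (partition_count (n - 2 - \<bar>m\<bar>))
       \<and> (real_of_int \<bar>m\<bar> \<ge> real_of_int n / 2 - 2 \<longrightarrow>
           rank_count m n = length_part_count (n - \<bar>m\<bar>))"
proof -
  define a where "a = nat \<bar>m\<bar>"
  have a: "int a = \<bar>m\<bar>" by (simp add: a_def)
  have "rank_count m n = rank_count \<bar>m\<bar> n"
    by (simp add: abs_if rank_count_minus)
  then have rank: "rank_count m n =
      card {M \<in> partition_msets (n - \<bar>m\<bar>). size M \<in># M \<and> (\<forall>x\<in>#M. x \<le> size M + a)}"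
    using rank_count_of_nat[of a n] a by simp
  have "rank_count m n \<le> length_part_count (n - \<bar>m\<bar>)"
    unfolding rank length_part_count_mset
    by (rule card_mono) (auto intro: finite_subset[OF _ finite_partition_msets])
  moreover have "int (length_part_count (n - \<bar>m\<bar>)) =
      int (partition_count (n - 1 - \<bar>m\<bar>)) - int (partition_count (n - 2 - \<bar>m\<bar>))"
    unfolding length_part_count_eq_without_1 card_partition_msets_without_1
    by (simp add: algebra_simps)
  moreover have "rank_count m n = length_part_count (n - \<bar>m\<bar>)"
    if "real_of_int \<bar>m\<bar> \<ge> real_of_int n / 2 - 2"
  proof -
    have "n - \<bar>m\<bar> \<le> int a + 4" using that a by linarith
    then have "x \<le> size M + a"
      if "M \<in> partition_msets (n - \<bar>m\<bar>)" "size M \<in># M" "x \<in># M" for M x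
      using that by (intro part_le_of_size_mem) (auto simp: partition_msets_def)
    then show ?thesis unfolding rank length_part_count_mset
      by (intro arg_cong[where f = card]) auto
  qed
  ultimately show ?thesis by blast
qed

end
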